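(* Let $\mathcal T$ be a conforming triangulation of a bounded two-dimensional polygonal (Lipschitz) domain $\Omega$, and let $k\ge1$ be odd. With the edge functions $B_\mu^E$ and edge functionals $J_\nu^E$ of the context, for all $\nu,\mu\in\{0,1,\dots,k-1\}$, all interior edges $E,E'\in\mathcal E_\Omega$ and all $u\in\overset{\bullet\bullet}{S_{k,0}}(\mathcal T)$ it holds $$J_\nu^E\bigl(B_\mu^{E'}\bigr)=\delta_{\nu,\mu}\,\delta_{E,E'},\qquad J_\nu^E(u)=0.$$
   Context: A conforming triangulation is a finite set of closed nondegenerate triangles with union $\overline\Omega$ such that any two intersect in the empty set, a common vertex or a common edge. $\mathcal E_\Omega$ is the set of edges not contained in $\partial\Omega$. $\varphi_{\mathbf z}=\varphi^1_{\mathbf z}$ is the continuous piecewise affine hat function of the mesh vertex $\mathbf z$. For $E\in\mathcal E_\Omega$ fix a numbering $\mathbf A_1(E),\mathbf A_2(E)$ of its endpoints and define the edge bubble $b_E=\varphi_{\mathbf A_1(E)}\varphi_{\mathbf A_2(E)}$. $P_n^{(\alpha,\beta)}$ is the Jacobi polynomial of degree $n$, orthogonal on $[-1,1]$ with respect to $(1-x)^\alpha(1+x)^\beta$ to all polynomials of degree $<n$, normalized by $P_n^{(\alpha,\beta)}(1)=(\alpha+1)_n/n!$ with $(a)_n=a(a+1)\cdots(a+n-1)$. For a triangle $K$ with barycentric coordinates $\lambda_{K,\mathbf z}$, $B_k^{\mathrm{CR},K}=\frac12\bigl(-1+\sum_{\mathbf z}P_k^{(0,0)}(1-2\lambda_{K,\mathbf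 z})\bigr)$ on $K$ (sum over the three vertices) and $0$ elsewhere. For an edge $E$, $B_k^{\mathrm{CR},E}=P_k^{(0,0)}(1-2\lambda_{K,E})-B_k^{\mathrm{CR},K}$ on each triangle $K\supset E$ and $0$ elsewhere, where $\lambda_{K,E}$ is the barycentric coordinate of the vertex of $K$ opposite to $E$. Edge functions: for $E\in\mathcal E_\Omega$, $B_\mu^E=b_E\,P_\mu^{(1,1)}(2\varphi_{\mathbf A_2(E)}-1)$ for $0\le\mu\le k-2$, and $B_{k-1}^E=B_k^{\mathrm{CR},E}$. Edge functionals: for $E\in\mathcal E_\Omega$ and $\nu\in\{0,\dots,k-1\}$, $J_\nu^Eu=\frac{2}{|E|}\int_E g_\nu^E\,u$ with $$g_\nu^E=\gamma_\nu\bigl(P_\nu^{(1,1)}(2\varphi_{\mathbf A_2(E)}-1)-c_{\nu,k}P_{k-1}^{(1,1)}(2\varphi_{\mathbf A_2(E)}-1)\bigr),\quad \gamma_\nu=\frac{(2\nu+3)(\nu+2)}{8(\nu+1)},$$ $c_{\nu,k}=\frac{1-(-1)^{\nu+1}}{2}\,\frac{k+1}{\nu+2}$ for $0\le\nu\le k-2$ and $c_{k-1,k}=\frac1{2k+1}$. (The weight $g_\nu^E$ is a polynomial of degree at most $k-1$ on $E$; for discontinuous $u=B_\mu^{E'}$ the jump across $E$ is $L^2(E)$-orthogonal to such polynomials, so the integral is the same for the traces on $E$ from either adjacent triangle.) $\overset{\bullet\bullet}{S_{k,0}}(\mathcal T)$ is the space of continuous functions on $\overline\Omega$ that are polynomials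 of degree $\le k$ on each triangle and vanish on all edges of the mesh.
   Formalization: The edge bubble is taken as b_E = 4 φ_{A_1(E)} φ_{A_2(E)} instead of φ_{A_1(E)} φ_{A_2(E)}; with the printed b_E the value J_ν^E(B_ν^E) would be 1/4 rather than 1 for ν ≤ k−2 (e.g. k=3, ν=0). *)

theory Defs
  imports "HOL-Analysis.Analysis" "HOL-Computational_Algebra.Polynomial"
begin

type_synonym pt = "real ^ 2"

section \<open>Domains and conforming triangulations\<close>

text \<open>In a suitable orthonormal frame centred at each boundary point, the domain is locally the
  region strictly above the graph of a Lipschitz function.\<close>

definition lipschitz_boundary :: "pt set \<Rightarrow> bool" where
  "lipschitz_boundary \<Omega> \<longleftrightarrow>
     (\<forall>x\<in>frontier \<Omega>. \<exists>e1 e2 r h L g.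
        norm e1 = 1 \<and> norm e2 = 1 \<and> e1 \<bullet> e2 = 0 \<and> 0 < r \<and> 0 < h \<and>
        L-lipschitz_on {-r<..<r} (g :: real \<Rightarrow> real) \<and>
        (\<forall>s t. \<bar>s\<bar> < r \<and> \<bar>t\<bar> < h \<longrightarrow> (x + s *\<^sub>R e1 + t *\<^sub>R e2 \<in> \<Omega> \<longleftrightarrow> g s < t)))"

definition polygonal_lipschitz_domain :: "pt set \<Rightarrow> bool" where
  "polygonal_lipschitz_domain \<Omega> \<longleftrightarrow>
     open \<Omega> \<and> connected \<Omega> \<and> \<Omega> \<noteq> {} \<and> bounded \<Omega> \<and> lipschitz_boundary \<Omega> \<and>
     (\<exists>S :: (pt \<times> pt) set. finite S \<and> frontier \<Omega> = (\<Union>(a, b)\<in>S. closed_segment a b))"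

text \<open>Used both for the three vertices of a triangle and for the two endpoints of an edge.\<close>

definition verts :: "pt set \<Rightarrow> pt set" where
  "verts K = {z. z extreme_point_of K}"

definition conforming_triangulation :: "pt set \<Rightarrow> pt set set \<Rightarrow> bool" where
  "conforming_triangulation \<Omega> T \<longleftrightarrow>
     finite T \<and> (\<forall>K\<in>T. 2 simplex K) \<and> \<Union>T = closure \<Omega> \<and>
     (\<forall>K\<in>T. \<forall>K'\<in>T. K \<noteq> K' \<longrightarrow>
        K \<inter> K' = {} \<or>
        (\<exists>z. z \<in> verts K \<and> z \<in> verts K' \<and> K \<inter> K' = {z}) \<or>
        ((K \<inter> K') edge_of K \<and> (K \<inter> K') edge_of K'))"

definition mesh_vertices :: "pt set set \<Rightarrow> pt set" where
  "mesh_vertices T = (\<Union>K\<in>T. verts K)"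

definition mesh_edges :: "pt set set \<Rightarrow> pt set set" where
  "mesh_edges T = {E. \<exists>K\<in>T. E edge_of K}"

definition interior_edges :: "pt set \<Rightarrow> pt set set \<Rightarrow> pt set set" where
  "interior_edges \<Omega> T = {E \<in> mesh_edges T. \<not> E \<subseteq> frontier \<Omega>}"

section \<open>Jacobi polynomials\<close>

text \<open>Natural-number parameters suffice: only \<open>(0,0)\<close> and \<open>(1,1)\<close> occur.\<close>

definition is_jacobi :: "nat \<Rightarrow> nat \<Rightarrow> nat \<Rightarrow> real poly \<Rightarrow> bool" where
  "is_jacobi n \<alpha> \<beta> p \<longleftrightarrow>
     degree p = n \<and>
     (\<forall>q. degree q < n \<longrightarrow>
        integral {-1..1} (\<lambda>x. (1 - x) ^ \<alpha> * (1 + x) ^ \<beta> * poly p x * poly q x) = 0) \<and>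
     poly p 1 = pochhammer (real \<alpha> + 1) n / fact n"

definition jacobi :: "nat \<Rightarrow> nat \<Rightarrow> nat \<Rightarrow> real \<Rightarrow> real" where
  "jacobi n \<alpha> \<beta> = poly (THE p. is_jacobi n \<alpha> \<beta> p)"

section \<open>Barycentric coordinates and hat functions\<close>

text \<open>The clause \<open>u v = 0\<close> off the vertices makes the coefficient function unique.\<close>

definition barycentric :: "pt set \<Rightarrow> pt \<Rightarrow> pt \<Rightarrow> real" where
  "barycentric K z x =
     (THE u. (\<forall>v. v \<notin> verts K \<longrightarrow> u v = 0) \<and> (\<Sum>v\<in>verts K. u v) = 1 \<and>
             (\<Sum>v\<in>verts K. u v *\<^sub>R v) = x) z"

definition hat_function :: "pt set set \<Rightarrow> pt \<Rightarrow> (pt \<Rightarrow> real) \<Rightarrow> bool" where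
  "hat_function T z \<phi> \<longleftrightarrow>
     continuous_on (\<Union>T) \<phi> \<and>
     (\<forall>K\<in>T. \<exists>a c. \<forall>x\<in>K. \<phi> x = a \<bullet> x + c) \<and>
     (\<forall>z'\<in>mesh_vertices T. \<phi> z' = (if z' = z then 1 else 0))"

text \<open>The defining conditions determine the values on \<open>\<Union>T\<close>; the values elsewhere are irrelevant.\<close>

definition hat :: "pt set set \<Rightarrow> pt \<Rightarrow> pt \<Rightarrow> real" where
  "hat T z = (SOME \<phi>. hat_function T z \<phi>)"

section \<open>Edge functions\<close>

text \<open>A piecewise smooth, possibly discontinuous function \<open>v\<close> on the mesh is represented by its
  branches: \<open>v K\<close> is its restriction to the closed triangle \<open>K\<close>, extended by its boundary traces
  taken from inside \<open>K\<close>.\<close>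

definition cr_triangle :: "nat \<Rightarrow> pt set \<Rightarrow> pt \<Rightarrow> real" where
  "cr_triangle k K x = (-1 + (\<Sum>z\<in>verts K. jacobi k 0 0 (1 - 2 * barycentric K z x))) / 2"

definition opposite_vertex :: "pt set \<Rightarrow> pt set \<Rightarrow> pt" where
  "opposite_vertex K E = (THE z. z \<in> verts K \<and> z \<notin> E)"

definition cr_edge :: "nat \<Rightarrow> pt set \<Rightarrow> pt set \<Rightarrow> pt \<Rightarrow> real" where
  "cr_edge k E K x =
     (if E edge_of K
      then jacobi k 0 0 (1 - 2 * barycentric K (opposite_vertex K E) x) - cr_triangle k K x
      else 0)"

text \<open>\<open>A1 E\<close> and \<open>A2 E\<close> are the numbered endpoints of \<open>E\<close>. The factor 4 normalizes the edge
  bubble to maximum 1. It is needed for biorthonormality: \<open>4 * t * (1 - t) = 1 - x\<^sup>2\<close> for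
  \<open>x = 2 * t - 1\<close> is exactly the Jacobi weight, whose norms the constants \<open>gam\<close> invert.
  The unscaled product of the two hat functions would give 1/4 instead of 1 for
  \<open>\<nu> = \<mu> \<le> k - 2\<close>.\<close>

definition edge_bubble ::
    "pt set set \<Rightarrow> (pt set \<Rightarrow> pt) \<Rightarrow> (pt set \<Rightarrow> pt) \<Rightarrow> pt set \<Rightarrow> pt \<Rightarrow> real" where
  "edge_bubble T A1 A2 E x = 4 * hat T (A1 E) x * hat T (A2 E) x"

definition edge_fun ::
    "pt set set \<Rightarrow> (pt set \<Rightarrow> pt) \<Rightarrow> (pt set \<Rightarrow> pt) \<Rightarrow> nat \<Rightarrow> nat \<Rightarrow> pt set \<Rightarrow> pt set \<Rightarrow> pt \<Rightarrow> real"
  where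
  "edge_fun T A1 A2 k \<mu> E K x =
     (if \<mu> < k - 1
      then edge_bubble T A1 A2 E x * jacobi \<mu> 1 1 (2 * hat T (A2 E) x - 1)
      else cr_edge k E K x)"

section \<open>Edge functionals\<close>

definition gam :: "nat \<Rightarrow> real" where
  "gam \<nu> = (2 * real \<nu> + 3) * (real \<nu> + 2) / (8 * (real \<nu> + 1))"

definition coef :: "nat \<Rightarrow> nat \<Rightarrow> real" where
  "coef \<nu> k =
     (if \<nu> < k - 1 then (1 - (-1) ^ (\<nu> + 1)) / 2 * ((real k + 1) / (real \<nu> + 2))
      else 1 / (2 * real k + 1))"

definition edge_weight :: "pt set set \<Rightarrow> (pt set \<Rightarrow> pt) \<Rightarrow> nat \<Rightarrow> nat \<Rightarrow> pt set \<Rightarrow> pt \<Rightarrow> real" where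
  "edge_weight T A2 k \<nu> E x =
     gam \<nu> * (jacobi \<nu> 1 1 (2 * hat T (A2 E) x - 1)
               - coef \<nu> k * jacobi (k - 1) 1 1 (2 * hat T (A2 E) x - 1))"

text \<open>Arc-length integral over the segment from \<open>a\<close> to \<open>b\<close>.\<close>

definition segment_integral :: "pt \<Rightarrow> pt \<Rightarrow> (pt \<Rightarrow> real) \<Rightarrow> real" where
  "segment_integral a b f = dist a b * integral {0..1} (\<lambda>t. f (linepath a b t))"

text \<open>The argument \<open>v\<close> is a function on the edge; for a discontinuous function it is the trace
  from one of the adjacent triangles.\<close>

definition edge_functional ::
    "pt set set \<Rightarrow> (pt set \<Rightarrow> pt) \<Rightarrow> (pt set \<Rightarrow> pt) \<Rightarrow> nat \<Rightarrow> nat \<Rightarrow> pt set \<Rightarrow> (pt \<Rightarrow> real) \<Rightarrow> real"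
  where
  "edge_functional T A1 A2 k \<nu> E v =
     2 / dist (A1 E) (A2 E) *
     segment_integral (A1 E) (A2 E) (\<lambda>x. edge_weight T A2 k \<nu> E x * v x)"

section \<open>Continuous piecewise polynomials vanishing on the mesh skeleton\<close>

definition poly2_on :: "nat \<Rightarrow> pt set \<Rightarrow> (pt \<Rightarrow> real) \<Rightarrow> bool" where
  "poly2_on k K u \<longleftrightarrow>
     (\<exists>c :: nat \<Rightarrow> nat \<Rightarrow> real. \<forall>x\<in>K. u x = (\<Sum>i\<le>k. \<Sum>j\<le>k - i. c i j * (x $ 1) ^ i * (x $ 2) ^ j))"

definition S_bubble :: "pt set \<Rightarrow> pt set set \<Rightarrow> nat \<Rightarrow> (pt \<Rightarrow> real) set" where
  "S_bubble \<Omega> T k =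
     {u. continuous_on (closure \<Omega>) u \<and> (\<forall>K\<in>T. poly2_on k K u) \<and>
         (\<forall>E\<in>mesh_edges T. \<forall>x\<in>E. u x = 0)}"

end

theory Submission
  imports Defs
begin

text \<open>On an edge \<open>E\<close> with endpoints \<open>A\<^sub>1, A\<^sub>2\<close> the substitution \<open>x = 2\<phi> - 1\<close>, where \<open>\<phi>\<close> is the
  hat function of \<open>A\<^sub>2\<close>, turns \<open>2/|E|\<close> times the integral over \<open>E\<close> into the integral over
  \<open>[-1, 1]\<close>. There the edge functions have simple traces: the bubble functions of \<open>E\<close> become
  \<open>(1 - x\<^sup>2) P\<^sub>\<mu>\<close> with \<open>P\<^sub>\<mu>\<close> the Jacobi polynomial for \<open>(1,1)\<close>, those of other edges vanish, and
  since \<open>k\<close> is odd the two Legendre terms of the triangle function on \<open>E\<close> cancel, so that the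
  Crouzeix-Raviart function has trace \<open>1\<close> for \<open>E\<close> and \<open>\<plusminus>L\<^sub>k\<close> or \<open>0\<close> for other edges. The
  statement thus reduces to three integrals: the norm of \<open>P\<^sub>\<mu>\<close>, which is \<open>1 / gam \<mu>\<close>, the mean of
  \<open>P\<^sub>\<nu>\<close>, which explains \<open>coef\<close>, and the orthogonality of \<open>L\<^sub>k\<close> to lower degrees. The first two
  follow from \<open>P\<^sub>n = 2/(n+2) L\<^sub>n\<^sub>+\<^sub>1'\<close>.\<close>

section \<open>Integration of polynomials over [-1,1]\<close>

text \<open>Integration is treated as a functional on polynomials themselves, so that derivatives,
  degrees and coefficients can be argued with algebraically.\<close>

definition poly_int :: "real poly \<Rightarrow> real" where
  "poly_int p = integral {-1..1} (poly p)"

lemma poly_integrable [intro, simp]: "poly (p :: real poly) integrable_on {a..b}"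
  by (intro integrable_continuous_interval continuous_intros)

lemma poly_int_add: "poly_int (p + q) = poly_int p + poly_int q"
  using integral_add[of "poly p" "{-1..1}" "poly q"] by (simp add: poly_int_def poly_add[abs_def])

lemma poly_int_smult: "poly_int (smult c p) = c * poly_int p"
  by (simp add: poly_int_def poly_smult[abs_def])

lemma poly_int_minus: "poly_int (- p) = - poly_int p"
  using poly_int_smult[of "-1" p] by simp

lemma poly_int_diff: "poly_int (p - q) = poly_int p - poly_int q"
  using poly_int_add[of p "- q"] by (simp add: poly_int_minus)

lemma poly_int_0 [simp]: "poly_int 0 = 0"
  using poly_int_smult[of 0 0] by simp

lemmas poly_int_linear = poly_int_add poly_int_diff poly_int_smult poly_int_minus

lemma poly_int_pderiv: "poly_int (pderiv p) = poly p 1 - poly p (- 1)"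
proof -
  have "(poly (pderiv p) has_integral (poly p 1 - poly p (- 1))) {-1..1}"
    by (rule fundamental_theorem_of_calculus)
      (auto intro!: has_real_derivative_iff_has_vector_derivative[THEN iffD1]
        DERIV_subset[OF poly_DERIV])
  then show ?thesis
    unfolding poly_int_def by (rule integral_unique)
qed

lemma poly_int_by_parts:
  "poly_int (pderiv p * q) = poly p 1 * poly q 1 - poly p (- 1) * poly q (- 1) - poly_int (p * pderiv q)"
  using poly_int_pderiv[of "p * q"] by (simp add: pderiv_mult poly_int_linear algebra_simps)

text \<open>A continuous nonnegative function with zero integral vanishes on all of [-1,1], and a
  nonzero polynomial has only finitely many roots.\<close>

lemma poly_int_eq_0_imp:
  assumes "poly_int p = 0" "\<And>x. x \<in> {-1..1} \<Longrightarrow> 0 \<le> poly p x"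
  shows "p = 0"
proof (rule ccontr)
  assume "p \<noteq> 0"
  have "continuous_on {-1..1} (poly p)" by (intro continuous_intros)
  then have "poly p x = 0" if "x \<in> {-1..1}" for x
    using integral_eq_0_iff[of "-1" 1 "poly p"] assms that
    by (simp add: poly_int_def)
  then have "{-1..1} \<subseteq> {x. poly p x = 0}" by auto
  with poly_roots_finite[OF \<open>p \<noteq> 0\<close>] have "finite {-1..1::real}"
    using finite_subset by blast
  then show False using infinite_Icc[of "-1 :: real" 1] by simp
qed

lemma poly_int_reflect: "poly_int (pcompose p [:0, -1:]) = poly_int p"
proof -
  have "integral {-1..1} (\<lambda>x. poly p (- x)) = integral {-1..1} (poly p)"
    using Henstock_Kurzweil_Integration.integral_reflect_real[of 1 "-1" "poly p"] by simp
  then show ?thesis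
    by (simp add: poly_int_def poly_pcompose[abs_def])
qed

text \<open>Substitution \<open>x = 2 * t - 1\<close>; the factor 2 is the one in front of the edge
  functionals.\<close>

lemma integral_unit_interval_eq_poly_int:
  "2 * integral {0..1} (\<lambda>t. poly p (2 * t - 1)) = poly_int p"
proof -
  have "(poly p has_integral poly_int p) {-1..1}"
    unfolding poly_int_def by (simp add: integrable_integral)
  from has_integral_affinity'[OF this[folded cbox_interval], of 2 "-1"]
  have "((\<lambda>t. poly p (2 * t - 1)) has_integral poly_int p / 2) {0..1}"
    by simp
  then show ?thesis by (simp add: integral_unique)
qed

section \<open>Orthogonal polynomials\<close>

text \<open>For parameters \<open>(0,0)\<close> this is 1, so the Legendre case is plain
  orthogonality under \<open>poly_int\<close>.\<close>

definition jacobi_weight :: "nat \<Rightarrow> nat \<Rightarrow> real poly" where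
  "jacobi_weight \<alpha> \<beta> = [:1, -1:] ^ \<alpha> * [:1, 1:] ^ \<beta>"

lemma is_jacobi_iff:
  "is_jacobi n \<alpha> \<beta> p \<longleftrightarrow> degree p = n \<and>
     (\<forall>q. degree q < n \<longrightarrow> poly_int (jacobi_weight \<alpha> \<beta> * p * q) = 0) \<and>
     poly p 1 = pochhammer (real \<alpha> + 1) n / fact n"
proof -
  have "poly (jacobi_weight \<alpha> \<beta> * p * q) = (\<lambda>x. (1 - x) ^ \<alpha> * (1 + x) ^ \<beta> * poly p x * poly q x)" for q
    by (auto simp: jacobi_weight_def)
  then show ?thesis unfolding is_jacobi_def poly_int_def by simp
qed

text \<open>The weight is nonnegative on [-1,1] and is not the zero polynomial: the weighted inner
  product is definite.\<close>

lemma jacobi_weight_orthogonal_imp_eq_0: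
  assumes "poly_int (jacobi_weight \<alpha> \<beta> * p * p) = 0"
  shows "p = 0"
proof -
  have "jacobi_weight \<alpha> \<beta> * p * p = 0"
    by (rule poly_int_eq_0_imp[OF assms]) (auto simp: jacobi_weight_def mult.assoc)
  then show ?thesis by (auto simp: jacobi_weight_def)
qed

text \<open>The difference of the two sides has no coefficient at \<open>n\<close>, hence degree
  below \<open>n\<close>, and is therefore orthogonal to itself. Cross-multiplied coefficients avoid
  division when a degree may drop.\<close>

lemma orthogonal_poly_proportional:
  assumes "degree p \<le> n" "degree q \<le> n"
    and "\<And>r. degree r < n \<Longrightarrow> poly_int (jacobi_weight \<alpha> \<beta> * p * r) = 0"
    and "\<And>r. degree r < n \<Longrightarrow> poly_int (jacobi_weight \<alpha> \<beta> * q * r) = 0"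
  shows "smult (coeff q n) p = smult (coeff p n) q"
proof (rule ccontr)
  define d where "d = smult (coeff q n) p - smult (coeff p n) q"
  assume "\<not> ?thesis"
  then have "d \<noteq> 0" by (simp add: d_def)
  have "degree d \<le> n"
    unfolding d_def using assms(1,2) by (intro degree_diff_le) (auto intro: order.trans[OF degree_smult_le])
  moreover have "coeff d n = 0" by (simp add: d_def)
  ultimately have "degree d < n"
    using \<open>d \<noteq> 0\<close> by (metis le_neq_implies_less leading_coeff_0_iff)
  moreover have "jacobi_weight \<alpha> \<beta> * d * d = smult (coeff q n) (jacobi_weight \<alpha> \<beta> * p * d)
      - smult (coeff p n) (jacobi_weight \<alpha> \<beta> * q * d)"
    by (simp add: d_def left_diff_distrib right_diff_distrib smult_diff_right ac_simps)
  ultimately have "poly_int (jacobi_weight \<alpha> \<beta> * d * d) = 0"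
    using assms(3,4) by (simp add: poly_int_linear)
  with jacobi_weight_orthogonal_imp_eq_0 \<open>d \<noteq> 0\<close> show False by blast
qed

text \<open>Orthogonality fixes the polynomial up to a factor and the positive value at 1 fixes the
  factor, so any witness is the one described by \<open>THE\<close>.\<close>

lemma jacobi_eqI:
  assumes p: "is_jacobi n \<alpha> \<beta> p"
  shows "jacobi n \<alpha> \<beta> = poly p"
proof -
  have "q = p" if q: "is_jacobi n \<alpha> \<beta> q" for q
  proof -
    have eq: "smult (coeff q n) p = smult (coeff p n) q"
      using p q by (intro orthogonal_poly_proportional[where \<alpha>=\<alpha> and \<beta>=\<beta>]) (auto simp: is_jacobi_iff)
    have "poly p 1 > 0"
      using p by (auto simp: is_jacobi_iff intro!: divide_pos_pos pochhammer_pos)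
    with arg_cong[OF eq, of "\<lambda>r. poly r 1"] p q have "coeff p n = coeff q n"
      by (auto simp: is_jacobi_iff)
    moreover have "coeff p n \<noteq> 0"
    proof
      assume "coeff p n = 0"
      with p have "p = 0" by (auto simp: is_jacobi_iff)
      with \<open>poly p 1 > 0\<close> show False by simp
    qed
    ultimately show ?thesis using eq by (metis smult_cancel)
  qed
  with p have "(THE p. is_jacobi n \<alpha> \<beta> p) = p" by blast
  then show ?thesis by (simp add: jacobi_def)
qed

text \<open>Gram-Schmidt by induction on the dimension \<open>n\<close>. "Degree below
  \<open>n\<close>" is expressed by coefficients, so that for \<open>n = 0\<close> it still admits
  the zero polynomial.\<close>

lemma exists_orthogonal_projection:
  "\<exists>r. (\<forall>i\<ge>n. coeff r i = 0) \<and>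
       (\<forall>q. (\<forall>i\<ge>n. coeff q i = 0) \<longrightarrow> poly_int ((f - r) * q) = 0)"
proof (induction n arbitrary: f)
  case 0
  have "q = 0" if "\<forall>i\<ge>0. coeff q i = 0" for q :: "real poly"
    using that by (simp add: poly_eq_iff)
  then show ?case by (intro exI[of _ 0]) (metis mult_zero_right coeff_0 poly_int_0)
next
  case (Suc n)
  obtain r where r: "\<forall>i\<ge>n. coeff r i = 0"
      "\<And>q. \<forall>i\<ge>n. coeff q i = 0 \<Longrightarrow> poly_int ((f - r) * q) = 0"
    using Suc.IH[of f] by blast
  obtain s where s: "\<forall>i\<ge>n. coeff s i = 0"
      "\<And>q. \<forall>i\<ge>n. coeff q i = 0 \<Longrightarrow> poly_int ((monom 1 n - s) * q) = 0"
    using Suc.IH[of "monom 1 n"] by blast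
  \<comment> \<open>The new basis vector: \<open>x^n\<close> made orthogonal to all lower
    degrees.\<close>
  define p where "p = monom 1 n - s"
  have p: "coeff p n = 1" "\<forall>i\<ge>Suc n. coeff p i = 0"
    using s(1) by (auto simp: p_def)
  then have "p \<noteq> 0" by auto
  have pp: "poly_int (p * p) \<noteq> 0"
  proof
    assume "poly_int (p * p) = 0"
    then have "p * p = 0" by (rule poly_int_eq_0_imp) simp
    with \<open>p \<noteq> 0\<close> show False by simp
  qed
  define c where "c = poly_int ((f - r) * p) / poly_int (p * p)"
  have "poly_int ((f - (r + smult c p)) * q) = 0" if q: "\<forall>i\<ge>Suc n. coeff q i = 0" for q
  proof -
    \<comment> \<open>Since \<open>p\<close> is monic, this removes the \<open>x^n\<close> term, and
      the induction hypotheses apply to \<open>q'\<close>.\<close>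
    define q' where "q' = q - smult (coeff q n) p"
    have "coeff q' i = 0" if "i \<ge> n" for i
      using p q that by (cases "i = n") (simp_all add: q'_def)
    then have q': "\<forall>i\<ge>n. coeff q' i = 0" by blast
    have "(f - (r + smult c p)) * q = smult (coeff q n) ((f - r) * p - smult c (p * p))
        + ((f - r) * q' - smult c (p * q'))"
      by (simp add: q'_def algebra_simps smult_add_right smult_diff_right)
    moreover have "poly_int ((f - r) * p - smult c (p * p)) = 0"
      using pp by (simp add: poly_int_linear c_def)
    moreover have "poly_int ((f - r) * q') = 0" "poly_int (p * q') = 0"
      using r(2)[OF q'] s(2)[OF q'] by (simp_all add: p_def)
    ultimately show ?thesis by (simp add: poly_int_linear)
  qed
  then show ?case
    using r(1) p(2) by (intro exI[of _ "r + smult c p"]) auto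
qed

lemma exists_monic_orthogonal:
  obtains p where "degree p = n" "lead_coeff p = 1"
    "\<And>q. degree q < n \<Longrightarrow> poly_int (p * q) = 0"
proof -
  obtain s where s: "\<forall>i\<ge>n. coeff s i = 0"
      "\<And>q. \<forall>i\<ge>n. coeff q i = 0 \<Longrightarrow> poly_int ((monom 1 n - s) * q) = 0"
    using exists_orthogonal_projection[of n "monom 1 n"] by blast
  define p where "p = monom 1 n - s"
  have "coeff p n = 1" "\<forall>i>n. coeff p i = 0" using s(1) by (auto simp: p_def)
  then have "degree p = n"
    by (metis degree_le le_degree le_antisym zero_neq_one)
  with \<open>coeff p n = 1\<close> s(2) show thesis
    by (intro that[of p]) (auto simp: p_def coeff_eq_0)
qed

text \<open>Reflection preserves degree and \<open>poly_int\<close>, so the reflected polynomial is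
  orthogonal to the same space and hence proportional to \<open>p\<close>; the leading coefficient
  gives the sign.\<close>

lemma orthogonal_reflect:
  assumes "degree p = n" and orth: "\<And>q. degree q < n \<Longrightarrow> poly_int (p * q) = 0"
  shows "pcompose p [:0, -1:] = smult ((-1) ^ n) p"
proof (cases "p = 0")
  case False
  have lc: "coeff (pcompose p [:0, -1:]) n = (-1) ^ n * coeff p n"
    using lead_coeff_comp[of "[:0, -1:]" p] assms(1) by (simp add: degree_pcompose)
  have "poly_int (pcompose p [:0, -1:] * q) = 0" if "degree q < n" for q
  proof -
    have "pcompose p [:0, -1:] * q = pcompose (p * pcompose q [:0, -1:]) [:0, -1:]"
      by (simp add: pcompose_mult pcompose_assoc[symmetric] pcompose_pCons)
    moreover have "degree (pcompose q [:0, -1:]) < n"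
      using that by (simp add: degree_pcompose)
    ultimately show ?thesis using orth by (simp add: poly_int_reflect)
  qed
  then have "smult (coeff p n) (pcompose p [:0, -1:]) = smult (coeff (pcompose p [:0, -1:]) n) p"
    using assms
    by (intro orthogonal_poly_proportional[where \<alpha>=0 and \<beta>=0])
       (auto simp: jacobi_weight_def degree_pcompose)
  then have "smult (coeff p n) (pcompose p [:0, -1:]) = smult (coeff p n) (smult ((-1) ^ n) p)"
    by (simp add: lc mult.commute)
  moreover have "coeff p n \<noteq> 0" using False assms(1) by auto
  ultimately show ?thesis by (metis smult_cancel)
qed simp

text \<open>Integrating \<open>x p p'\<close> by parts and using that \<open>x p' - n p\<close> has degree below \<open>n\<close>. In
  particular \<open>p\<close> does not vanish at 1, so that it can be normalized there.\<close>

lemma norm_orthogonal_poly: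
  assumes deg: "degree p = n" and orth: "\<And>q. degree q < n \<Longrightarrow> poly_int (p * q) = 0"
  shows "(2 * real n + 1) * poly_int (p * p) = 2 * (poly p 1)\<^sup>2"
proof -
  define r where "r = [:0, 1:] * pderiv p - smult (real n) p"
  have "poly_int (p * r) = 0"
  proof (cases n)
    case 0
    with deg obtain c where "p = [:c:]" by (metis degree_eq_zeroE)
    with 0 show ?thesis by (simp add: r_def pderiv_pCons)
  next
    case (Suc m)
    have "degree r \<le> n"
      unfolding r_def using deg Suc
      by (intro degree_diff_le order.trans[OF degree_mult_le] order.trans[OF degree_smult_le])
         (auto simp: degree_pderiv)
    moreover have "coeff r n = 0"
      by (simp add: r_def Suc coeff_pderiv)
    ultimately have "degree r < n"
      using Suc by (metis degree_0 le_neq_implies_less leading_coeff_0_iff zero_less_Suc)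
    then show ?thesis by (rule orth)
  qed
  then have "poly_int (p * ([:0, 1:] * pderiv p)) = real n * poly_int (p * p)"
    by (simp add: r_def right_diff_distrib poly_int_linear)
  moreover have "poly p (- 1) * poly p (- 1) = poly p 1 * poly p 1"
    using arg_cong[OF orthogonal_reflect[OF deg orth], of "\<lambda>q. poly q 1"]
    by (simp add: poly_pcompose)
  moreover have "pderiv ([:0, 1:] * p) = [:0, 1:] * pderiv p + p"
    by (simp only: pderiv_mult) (simp add: pderiv_pCons)
  then have "poly_int (pderiv p * ([:0, 1:] * p)) = poly p 1 * poly p 1 + poly p (- 1) * poly p (- 1)
      - poly_int (p * ([:0, 1:] * pderiv p)) - poly_int (p * p)"
    by (simp only: poly_int_by_parts) (simp add: distrib_left poly_int_linear)
  moreover have "pderiv p * ([:0, 1:] * p) = p * ([:0, 1:] * pderiv p)" by (simp only: ac_simps)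
  ultimately show ?thesis by (simp add: power2_eq_square algebra_simps)
qed

section \<open>Legendre polynomials: existence, parity and norm\<close>

text \<open>By \<open>norm_orthogonal_poly\<close> the monic orthogonal polynomial is nonzero at 1,
  so it can be divided by its value there.\<close>

lemma exists_legendre: "\<exists>p. is_jacobi n 0 0 p"
proof -
  obtain p where p: "degree p = n" "lead_coeff p = 1"
    "\<And>q. degree q < n \<Longrightarrow> poly_int (p * q) = 0"
    using exists_monic_orthogonal by blast
  have "poly_int (p * p) \<noteq> 0"
    using p(2) jacobi_weight_orthogonal_imp_eq_0[of 0 0 p] by (auto simp: jacobi_weight_def)
  with norm_orthogonal_poly[OF p(1,3)] have "poly p 1 \<noteq> 0" by auto
  with p show ?thesis
    by (intro exI[of _ "smult (1 / poly p 1) p"])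
       (auto simp: is_jacobi_iff jacobi_weight_def poly_int_linear pochhammer_fact[symmetric])
qed

definition legendre_poly :: "nat \<Rightarrow> real poly" where
  "legendre_poly n = (SOME p. is_jacobi n 0 0 p)"

lemma is_jacobi_legendre_poly: "is_jacobi n 0 0 (legendre_poly n)"
  unfolding legendre_poly_def by (rule someI_ex[OF exists_legendre])

lemma jacobi_00: "jacobi n 0 0 = poly (legendre_poly n)"
  by (rule jacobi_eqI[OF is_jacobi_legendre_poly])

lemma degree_legendre [simp]: "degree (legendre_poly n) = n"
  and legendre_orthogonal: "degree q < n \<Longrightarrow> poly_int (legendre_poly n * q) = 0"
  and legendre_at_1 [simp]: "poly (legendre_poly n) 1 = 1"
  using is_jacobi_legendre_poly[of n]
  by (auto simp: is_jacobi_iff jacobi_weight_def pochhammer_fact[symmetric])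

lemma legendre_neq_0: "legendre_poly n \<noteq> 0"
  using legendre_at_1[of n] by fastforce

lemma legendre_minus: "poly (legendre_poly n) (- x) = (- 1) ^ n * poly (legendre_poly n) x"
  using arg_cong[OF orthogonal_reflect[OF degree_legendre legendre_orthogonal, of n], of "\<lambda>q. poly q x"]
  by (simp add: poly_pcompose)

lemma legendre_norm: "poly_int (legendre_poly n * legendre_poly n) = 2 / (2 * real n + 1)"
  using norm_orthogonal_poly[OF degree_legendre legendre_orthogonal, of n]
  by (simp add: field_simps)

section \<open>The weight \<open>1 - x^2\<close> and the Legendre differential equation\<close>

lemma jacobi_weight_11: "jacobi_weight 1 1 = [:1, 0, -1:]"
  by (simp add: jacobi_weight_def)

lemma degree_pderiv_weight_mult: "degree (pderiv ([:1, 0, -1:] * q)) \<le> Suc (degree (q :: real poly))"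
  using degree_mult_le[of "[:1, 0, -1:]" q] by (simp add: degree_pderiv)

text \<open>The weight vanishes at both endpoints, so there are no boundary terms.\<close>

lemma poly_int_by_parts_weight:
  "poly_int (pderiv p * ([:1, 0, -1:] * q)) = - poly_int (p * pderiv ([:1, 0, -1:] * q))"
  by (simp only: poly_int_by_parts) (simp add: algebra_simps)

text \<open>The left side has degree at most \<open>n\<close> and is orthogonal to all lower
  degrees, hence is a multiple of the Legendre polynomial; comparing coefficients at
  \<open>n\<close> gives the eigenvalue.\<close>

lemma legendre_differential_equation:
  "pderiv ([:1, 0, -1:] * pderiv (legendre_poly n)) = smult (- (real n * (real n + 1))) (legendre_poly n)"
  (is "?A = _")
proof -
  let ?L = "legendre_poly n" and ?W = "[:1, 0, -1:] :: real poly"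
  have coeff: "coeff ?A n = - (real n * (real n + 1)) * coeff ?L n"
  proof (cases n)
    case 0
    then have "pderiv ?L = 0" by (simp add: pderiv_eq_0_iff)
    with 0 show ?thesis by simp
  next
    case (Suc m)
    then have "coeff (?W * pderiv ?L) (Suc n) = - (real n * coeff ?L n)"
      by (simp add: coeff_pderiv coeff_eq_0)
    then show ?thesis
      by (simp only: coeff_pderiv[of "?W * pderiv ?L"]) simp
  qed
  have deg: "degree ?A \<le> n"
  proof (cases n)
    case 0
    then have "pderiv ?L = 0" by (simp add: pderiv_eq_0_iff)
    then show ?thesis by simp
  next
    case (Suc m)
    then show ?thesis
      using degree_pderiv_weight_mult[of "pderiv ?L"] by (simp add: degree_pderiv)
  qed
  \<comment> \<open>Two integrations by parts move the operator onto \<open>q\<close>, where it does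
    not raise the degree.\<close>
  have orth: "poly_int (?A * q) = 0" if "degree q < n" for q
  proof -
    have parts: "poly_int (?A * q) = - poly_int (?W * pderiv ?L * pderiv q)"
      by (simp only: poly_int_by_parts) simp
    \<comment> \<open>Constant \<open>q\<close> is separate: the degree bound would then give 1
      instead of 0, which need not lie below \<open>n\<close>.\<close>
    show ?thesis
    proof (cases "pderiv q = 0")
      case True
      with parts show ?thesis by simp
    next
      case False
      then have "degree q \<noteq> 0" by (simp add: pderiv_eq_0_iff)
      note parts
      also have "?W * pderiv ?L * pderiv q = pderiv ?L * (?W * pderiv q)"
        by (simp only: ac_simps)
      also have "- poly_int \<dots> = poly_int (?L * pderiv (?W * pderiv q))"
        by (simp only: poly_int_by_parts_weight minus_minus)
      also have "\<dots> = 0"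
        using degree_pderiv_weight_mult[of "pderiv q"] that \<open>degree q \<noteq> 0\<close>
        by (intro legendre_orthogonal) (simp add: degree_pderiv)
      finally show ?thesis .
    qed
  qed
  have "smult (coeff ?L n) ?A = smult (coeff ?A n) ?L"
    using deg orth legendre_orthogonal[of _ n]
    by (intro orthogonal_poly_proportional[where \<alpha>=0 and \<beta>=0]) (auto simp: jacobi_weight_def)
  then have "smult (coeff ?L n) ?A = smult (coeff ?L n) (smult (- (real n * (real n + 1))) ?L)"
    by (simp only: coeff) (simp add: mult.commute)
  moreover have "coeff ?L n \<noteq> 0" using legendre_neq_0[of n] by (metis degree_legendre leading_coeff_0_iff)
  ultimately show ?thesis by (metis smult_cancel)
qed

text \<open>The differential equation evaluated at 1, where the second-order term vanishes.\<close>

lemma pderiv_legendre_at_1: "poly (pderiv (legendre_poly n)) 1 = real n * (real n + 1) / 2"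
proof -
  have "pderiv ([:1, 0, -1:] * pderiv (legendre_poly n)) =
      [:1, 0, -1:] * pderiv (pderiv (legendre_poly n)) + pderiv (legendre_poly n) * [:0, -2:]"
    by (simp only: pderiv_mult) (simp add: pderiv_pCons)
  with legendre_differential_equation[of n]
  have "poly (smult (- (real n * (real n + 1))) (legendre_poly n)) 1 = - 2 * poly (pderiv (legendre_poly n)) 1"
    by simp
  then show ?thesis by simp
qed

section \<open>Jacobi polynomials for the parameters \<open>(1,1)\<close>\<close>

text \<open>By \<open>pderiv_legendre_at_1\<close> the factor makes the value at 1 equal to
  \<open>n + 1\<close>, the prescribed normalization.\<close>

definition jacobi11_poly :: "nat \<Rightarrow> real poly" where
  "jacobi11_poly n = smult (2 / (real n + 2)) (pderiv (legendre_poly (Suc n)))"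

text \<open>After integration by parts the Legendre polynomial of degree \<open>n + 1\<close> meets
  a polynomial of degree at most \<open>n\<close>.\<close>

lemma jacobi11_orthogonal:
  assumes "degree q < n"
  shows "poly_int ([:1, 0, -1:] * jacobi11_poly n * q) = 0"
proof -
  have "poly_int (pderiv (legendre_poly (Suc n)) * ([:1, 0, -1:] * q)) = 0"
    unfolding poly_int_by_parts_weight
    using degree_pderiv_weight_mult[of q] assms by (simp add: legendre_orthogonal)
  moreover have "[:1, 0, -1:] * jacobi11_poly n * q =
      smult (2 / (real n + 2)) (pderiv (legendre_poly (Suc n)) * ([:1, 0, -1:] * q))"
    by (simp only: jacobi11_poly_def mult_smult_left mult_smult_right ac_simps)
  ultimately show ?thesis by (simp only: poly_int_smult)
qed

lemma degree_jacobi11 [simp]: "degree (jacobi11_poly n) = n"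
  by (simp add: jacobi11_poly_def degree_pderiv)

lemma jacobi_11: "jacobi n 1 1 = poly (jacobi11_poly n)"
proof (rule jacobi_eqI)
  have "pochhammer 2 n = (fact (Suc n) :: real)"
    using pochhammer_rec[of "1::real" n] by (simp add: pochhammer_fact)
  then have "poly (jacobi11_poly n) 1 = pochhammer 2 n / fact n"
    by (simp add: jacobi11_poly_def pderiv_legendre_at_1 field_simps)
  then show "is_jacobi n 1 1 (jacobi11_poly n)"
    unfolding is_jacobi_iff jacobi_weight_11 using jacobi11_orthogonal by simp
qed

lemma jacobi11_norm:
  "poly_int ([:1, 0, -1:] * jacobi11_poly n * jacobi11_poly m) = (if n = m then 1 / gam n else 0)"
proof (cases n m rule: linorder_cases)
  case less
  have "[:1, 0, -1:] * jacobi11_poly n * jacobi11_poly m = [:1, 0, -1:] * jacobi11_poly m * jacobi11_poly n"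
    by (simp only: ac_simps)
  with less show ?thesis by (simp only: jacobi11_orthogonal degree_jacobi11) simp
next
  case equal
  let ?L = "legendre_poly (Suc n)"
  have "[:1, 0, -1:] * jacobi11_poly n * jacobi11_poly n =
      smult ((2 / (real n + 2))\<^sup>2) (pderiv ?L * ([:1, 0, -1:] * pderiv ?L))"
    by (simp add: jacobi11_poly_def mult_ac power2_eq_square)
  \<comment> \<open>Integration by parts and the differential equation leave the eigenvalue
    \<open>(n + 1) * (n + 2)\<close> times the squared norm of \<open>?L\<close>.\<close>
  moreover have "poly_int (pderiv ?L * ([:1, 0, -1:] * pderiv ?L)) =
      (real n + 1) * (real n + 2) * (2 / (2 * real n + 3))"
    unfolding poly_int_by_parts_weight legendre_differential_equation
    by (simp add: poly_int_linear legendre_norm algebra_simps)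
  ultimately have "poly_int ([:1, 0, -1:] * jacobi11_poly n * jacobi11_poly n) =
      (2 / (real n + 2))\<^sup>2 * ((real n + 1) * (real n + 2) * (2 / (2 * real n + 3)))"
    by (simp only: poly_int_smult)
  also have "\<dots> = 1 / gam n"
    by (simp add: gam_def divide_simps power2_eq_square)
  finally show ?thesis using equal by simp
next
  case greater
  then show ?thesis by (simp only: jacobi11_orthogonal degree_jacobi11) simp
qed

text \<open>The integrand is a derivative; the Legendre endpoint values produce the parity factor
  seen in \<open>coef\<close>.\<close>

lemma poly_int_jacobi11: "poly_int (jacobi11_poly n) = 2 * (1 - (- 1) ^ (n + 1)) / (real n + 2)"
  by (simp add: jacobi11_poly_def poly_int_linear poly_int_pderiv legendre_minus)

lemma gam_pos: "gam n > 0"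
  by (simp add: gam_def)

section \<open>Triangles, edges and hat functions\<close>

text \<open>The extreme points of a hull of affinely independent points are exactly these
  points.\<close>

lemma simplex_verts:
  assumes "n simplex K"
  shows "\<not> affine_dependent (verts K)" "finite (verts K)" "int (card (verts K)) = n + 1"
    "K = convex hull (verts K)"
proof -
  obtain C where C: "\<not> affine_dependent C" "int (card C) = n + 1" "K = convex hull C"
    using assms by (auto simp: simplex_def)
  then have "verts K = C"
    by (auto simp: verts_def extreme_point_of_convex_hull_affine_independent)
  with C aff_independent_finite show "\<not> affine_dependent (verts K)" "finite (verts K)"
    "int (card (verts K)) = n + 1" "K = convex hull (verts K)" by auto
qed

text \<open>A face of a simplex is the hull of some of its vertices, and dimension 1 forces two of
  them. The third vertex lies off \<open>E\<close>, as an extreme point of \<open>K\<close> in a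
  face is extreme in the face.\<close>

lemma edge_of_triangle:
  assumes "2 simplex K" "E edge_of K"
  shows "card (verts E) = 2" "E = convex hull (verts E)"
    "\<exists>c. c \<notin> E \<and> verts K = insert c (verts E)"
proof -
  note K = simplex_verts[OF assms(1)]
  have E: "E face_of K" "aff_dim E = 1" using assms(2) by (auto simp: edge_of_def)
  obtain C where C: "C \<subseteq> verts K" "E = convex hull C"
    using face_of_convex_hull_affine_independent[OF K(1), of E] E(1) K(4) by auto
  have ind: "\<not> affine_dependent C" using K(1) C(1) affine_dependent_subset by blast
  then have vE: "verts E = C"
    by (auto simp: verts_def C(2) extreme_point_of_convex_hull_affine_independent)
  show card: "card (verts E) = 2"
    unfolding vE using E(2) aff_dim_affine_independent[OF ind] by (simp add: C(2) aff_dim_convex_hull)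
  show "E = convex hull (verts E)" using C(2) vE by simp
  have "card (verts K - verts E) = 1"
    using card K(2,3) C(1) vE by (simp add: card_Diff_subset finite_subset)
  then obtain c where c: "verts K - verts E = {c}" by (auto simp: card_1_singleton_iff)
  have "c \<notin> E"
  proof
    assume "c \<in> E"
    moreover have "c extreme_point_of K" using c by (auto simp: verts_def)
    ultimately have "c \<in> verts E"
      using E(1) by (auto simp: verts_def extreme_point_of_face)
    with c show False by blast
  qed
  with c C(1) vE show "\<exists>c. c \<notin> E \<and> verts K = insert c (verts E)" by blast
qed

lemma verts_subset: "verts K \<subseteq> K"
  by (auto simp: verts_def extreme_point_of_def)

text \<open>Two different coefficient functions for one point would differ by an affine dependence
  among the vertices.\<close>

lemma barycentric_eqI:
  assumes ind: "\<not> affine_dependent (verts K)" and fin: "finite (verts K)"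
    and u: "\<And>v. v \<notin> verts K \<Longrightarrow> u v = 0" "(\<Sum>v\<in>verts K. u v) = 1"
      "(\<Sum>v\<in>verts K. u v *\<^sub>R v) = x"
  shows "barycentric K z x = u z"
proof -
  have "u' = u" if u': "\<forall>v. v \<notin> verts K \<longrightarrow> u' v = 0" "(\<Sum>v\<in>verts K. u' v) = 1"
      "(\<Sum>v\<in>verts K. u' v *\<^sub>R v) = x" for u'
  proof (rule ccontr)
    assume "u' \<noteq> u"
    then obtain v where "u' v \<noteq> u v" by blast
    with u(1) u'(1) have "v \<in> verts K" by metis
    with \<open>u' v \<noteq> u v\<close> have "affine_dependent (verts K)"
      unfolding affine_dependent_explicit using fin u(2,3) u'(2,3)
      by (intro exI[of _ "verts K"] exI[of _ "\<lambda>v. u' v - u v"])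
         (auto simp: sum_subtractf scaleR_diff_left)
    with ind show False by blast
  qed
  then have "(THE u. (\<forall>v. v \<notin> verts K \<longrightarrow> u v = 0) \<and> (\<Sum>v\<in>verts K. u v) = 1 \<and>
      (\<Sum>v\<in>verts K. u v *\<^sub>R v) = x) = u"
    using u by (intro the_equality) blast+
  then show ?thesis by (simp add: barycentric_def)
qed

lemma barycentric_linepath:
  assumes "\<not> affine_dependent (verts K)" "finite (verts K)"
    and "a \<in> verts K" "b \<in> verts K" "a \<noteq> b"
  shows "barycentric K z (linepath a b t) = (if z = a then 1 - t else if z = b then t else 0)"
proof (rule barycentric_eqI[OF assms(1,2)])
  have *: "(\<Sum>v\<in>verts K. f v) = f a + f b"
    if "\<And>v. v \<in> verts K - {a, b} \<Longrightarrow> f v = 0" for f :: "pt \<Rightarrow> 'b::comm_monoid_add"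
  proof -
    have "(\<Sum>v\<in>verts K. f v) = (\<Sum>v\<in>{a, b}. f v)"
      using assms that by (intro sum.mono_neutral_right) auto
    then show ?thesis using assms(5) by simp
  qed
  show "(\<Sum>v\<in>verts K. if v = a then 1 - t else if v = b then t else 0) = 1"
    using assms(5) by (subst *) auto
  show "(\<Sum>v\<in>verts K. (if v = a then 1 - t else if v = b then t else 0) *\<^sub>R v) = linepath a b t"
    using assms(5) by (subst *) (auto simp: linepath_def)
qed (use assms in auto)

text \<open>Translating one point to the origin turns affine into linear independence, and
  prescribed values then extend to a linear functional.\<close>

lemma affine_interpolation:
  fixes S :: "'a::euclidean_space set"
  assumes "\<not> affine_dependent S"
  shows "\<exists>a c. \<forall>x\<in>S. a \<bullet> x + c = g x"
proof (cases "S = {}")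
  case False
  then obtain s where s: "s \<in> S" by blast
  have "independent ((\<lambda>x. x - s) ` (S - {s}))"
    using affine_dependent_iff_dependent[of s "S - {s}"] assms s
    by (simp add: insert_absorb image_def Setcompr_eq_image)
  from linear_independent_extend[OF this, of "\<lambda>y. g (y + s) - g s"]
  obtain h :: "'a \<Rightarrow> real" where h: "linear h" "\<And>x. x \<in> S - {s} \<Longrightarrow> h (x - s) = g x - g s"
    by auto
  \<comment> \<open>\<open>adjoint h 1\<close> is the vector representing the functional
    \<open>h\<close>.\<close>
  have "adjoint h 1 \<bullet> x = h x" for x
    using adjoint_works[OF h(1), of x 1] by (simp add: inner_commute)
  then have "adjoint h 1 \<bullet> x + (g s - h s) = g x" if "x \<in> S" for x
    using h(2)[of x] that linear_diff[OF h(1), of x s] by (cases "x = s") auto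
  then show ?thesis by blast
qed auto

lemma affine_linepath:
  "a \<bullet> linepath v w t + c = (1 - t) * (a \<bullet> v + c) + t * (a \<bullet> w + c)"
  by (simp add: linepath_def inner_simps algebra_simps)

text \<open>Ensures that the choice in \<open>hat\<close> is meaningful. The affine interpolants of
  the vertex values on the single triangles are glued along a finite closed cover.\<close>

lemma hat_function_exists:
  assumes "conforming_triangulation \<Omega> T"
  shows "\<exists>\<phi>. hat_function T z \<phi>"
proof -
  have fin: "finite T" and simplex: "\<And>K. K \<in> T \<Longrightarrow> 2 simplex K"
    using assms by (auto simp: conforming_triangulation_def)
  have "\<forall>K\<in>T. \<exists>a c. \<forall>v\<in>verts K. a \<bullet> v + c = (if v = z then 1 else 0)"
    by (intro ballI affine_interpolation) (rule simplex_verts(1)[OF simplex])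
  then obtain a c where ac:
    "\<And>K v. K \<in> T \<Longrightarrow> v \<in> verts K \<Longrightarrow> a K \<bullet> v + c K = (if v = z then 1 else 0)"
    by metis
  \<comment> \<open>Conformity enters here: two triangles meet in a common vertex or edge, and on an
    edge both affine functions are determined by the same two endpoint values.\<close>
  have agree: "a K \<bullet> x + c K = a K' \<bullet> x + c K'" if K: "K \<in> T" "K' \<in> T" and x: "x \<in> K" "x \<in> K'" for K K' x
  proof (cases "K = K'")
    case False
    with assms K x consider z' where "z' \<in> verts K" "z' \<in> verts K'" "K \<inter> K' = {z'}"
      | "(K \<inter> K') edge_of K" "(K \<inter> K') edge_of K'"
      unfolding conforming_triangulation_def by (metis IntI empty_iff)
    then show ?thesis
    proof cases
      case 1
      with x have "x = z'" by blast
      with 1 ac K show ?thesis by simp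
    next
      case 2
      note F = edge_of_triangle[OF simplex[OF K(1)] 2(1)]
      obtain v w where vw: "verts (K \<inter> K') = {v, w}" using F(1) by (auto simp: card_2_iff)
      with F(2) x have "x \<in> closed_segment v w" by (metis IntI segment_convex_hull)
      then obtain t where "x = linepath v w t" by (auto simp: in_segment linepath_def)
      moreover have "v \<in> verts K" "w \<in> verts K" using F(3) vw by auto
      moreover have "v \<in> verts K'" "w \<in> verts K'"
        using edge_of_triangle(3)[OF simplex[OF K(2)] 2(2)] vw by auto
      ultimately show ?thesis using ac K by (simp add: affine_linepath)
    qed
  qed simp
  define \<phi> where "\<phi> x = (let K = SOME K. K \<in> T \<and> x \<in> K in a K \<bullet> x + c K)" for x
  have \<phi>: "\<phi> x = a K \<bullet> x + c K" if "K \<in> T" "x \<in> K" for K x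
  proof -
    have "(SOME K. K \<in> T \<and> x \<in> K) \<in> T \<and> x \<in> (SOME K. K \<in> T \<and> x \<in> K)"
      using that by (intro someI_ex[of "\<lambda>K. K \<in> T \<and> x \<in> K"]) blast
    then show ?thesis unfolding \<phi>_def Let_def using agree that by blast
  qed
  have "continuous_on (\<Union>K\<in>T. K) \<phi>"
  proof (rule continuous_on_closed_Union[OF fin])
    fix K assume K: "K \<in> T"
    show "closed K"
      using simplex[OF K] compact_imp_closed compact_simplex by blast
    have "continuous_on K (\<lambda>x. a K \<bullet> x + c K)" by (intro continuous_intros)
    then show "continuous_on K \<phi>"
      using \<phi>[OF K] by (simp cong: continuous_on_cong)
  qed
  moreover have "\<phi> v = (if v = z then 1 else 0)" if "v \<in> mesh_vertices T" for v
    using that \<phi> ac verts_subset unfolding mesh_vertices_def by fastforce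
  ultimately have "hat_function T z \<phi>"
    unfolding hat_function_def using \<phi> by auto
  then show ?thesis by blast
qed

text \<open>Every hat function is affine on \<open>K\<close> with known vertex values, so the result
  is independent of the choice made; the range of \<open>t\<close> keeps the point in
  \<open>K\<close>.\<close>

lemma hat_linepath:
  assumes T: "conforming_triangulation \<Omega> T" and K: "K \<in> T" and vw: "v \<in> verts K" "w \<in> verts K"
    and t: "t \<in> {0..1}"
  shows "hat T z (linepath v w t) = (1 - t) * (if v = z then 1 else 0) + t * (if w = z then 1 else 0)"
proof -
  have hat: "hat_function T z (hat T z)"
    unfolding hat_def by (rule someI_ex[OF hat_function_exists[OF T]])
  then obtain a c where ac: "\<And>x. x \<in> K \<Longrightarrow> hat T z x = a \<bullet> x + c"
    using K unfolding hat_function_def by metis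
  have at: "hat T z u = (if u = z then 1 else 0)" if "u \<in> verts K" for u
    using hat K that unfolding hat_function_def mesh_vertices_def by blast
  have "convex K"
    using T K convex_simplex by (auto simp: conforming_triangulation_def)
  moreover have "v \<in> K" "w \<in> K" using vw verts_subset by auto
  ultimately have "linepath v w t \<in> K"
    using t closed_segment_subset linepath_in_path by blast
  then have "hat T z (linepath v w t) = (1 - t) * hat T z v + t * hat T z w"
    using ac \<open>v \<in> K\<close> \<open>w \<in> K\<close> by (simp add: affine_linepath)
  then show ?thesis using at vw by simp
qed

lemma opposite_vertex_eq:
  assumes "2 simplex K" "E edge_of K"
  shows "opposite_vertex K E \<notin> E" "verts K = insert (opposite_vertex K E) (verts E)"
proof -
  obtain c where c: "c \<notin> E" "verts K = insert c (verts E)"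
    using edge_of_triangle(3)[OF assms] by blast
  have "opposite_vertex K E = c"
    unfolding opposite_vertex_def using c verts_subset[of E] by (intro the_equality) auto
  with c show "opposite_vertex K E \<notin> E" "verts K = insert (opposite_vertex K E) (verts E)" by auto
qed

section \<open>Traces and functionals on an edge\<close>

text \<open>The coordinates on the edge are 0, \<open>1 - t\<close> and \<open>t\<close>. The first
  contributes 1, and the arguments of the other two Legendre terms are opposite, so these cancel for
  odd \<open>k\<close>.\<close>

lemma cr_triangle_linepath:
  assumes K: "2 simplex K" and E: "E edge_of K" and ab: "verts E = {a, b}" and "odd k"
  shows "cr_triangle k K (linepath a b t) = 0"
proof -
  note V = simplex_verts[OF K]
  let ?o = "opposite_vertex K E"
  have "a \<noteq> b" using edge_of_triangle(1)[OF K E] ab by auto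
  have o: "verts K = {?o, a, b}" "?o \<noteq> a" "?o \<noteq> b"
    using opposite_vertex_eq[OF K E] verts_subset[of E] ab by auto
  have bar: "barycentric K z (linepath a b t) = (if z = a then 1 - t else if z = b then t else 0)" for z
    using V(1,2) \<open>a \<noteq> b\<close> o(1) by (intro barycentric_linepath) auto
  have "(\<Sum>z\<in>verts K. jacobi k 0 0 (1 - 2 * barycentric K z (linepath a b t))) =
      (\<Sum>z\<in>{?o, a, b}. jacobi k 0 0 (1 - 2 * barycentric K z (linepath a b t)))"
    using o(1) by simp
  also have "\<dots> = 1 + poly (legendre_poly k) (- (1 - 2 * t)) + poly (legendre_poly k) (1 - 2 * t)"
    using o(2,3) \<open>a \<noteq> b\<close> by (simp add: bar jacobi_00)
  also have "\<dots> = 1" using \<open>odd k\<close> by (subst legendre_minus) simp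
  finally show ?thesis by (simp add: cr_triangle_def)
qed

text \<open>Only the Legendre term of the opposite vertex survives. For \<open>E\<close> its
  coordinate is 0; for another edge of \<open>K\<close> that vertex is \<open>a\<close> or
  \<open>b\<close>, which gives \<open>s = 1\<close> or \<open>s = -1\<close>; for an edge not in
  \<open>K\<close>, \<open>s = 0\<close>.\<close>

lemma cr_edge_linepath:
  assumes K: "2 simplex K" and E: "E edge_of K" and ab: "verts E = {a, b}" and "odd k"
  shows "cr_edge k E K (linepath a b t) = 1"
    and "E' \<noteq> E \<Longrightarrow> \<exists>s. \<forall>t. cr_edge k E' K (linepath a b t) = s * poly (legendre_poly k) (2 * t - 1)"
proof -
  note V = simplex_verts[OF K]
  let ?o = "opposite_vertex K E"
  have "a \<noteq> b" using edge_of_triangle(1)[OF K E] ab by auto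
  have o: "verts K = {?o, a, b}" "?o \<noteq> a" "?o \<noteq> b"
    using opposite_vertex_eq[OF K E] verts_subset[of E] ab by auto
  have bar: "barycentric K z (linepath a b t) = (if z = a then 1 - t else if z = b then t else 0)" for z t
    using V(1,2) \<open>a \<noteq> b\<close> o(1) by (intro barycentric_linepath) auto
  note tri = cr_triangle_linepath[OF K E ab \<open>odd k\<close>]
  show "cr_edge k E K (linepath a b t) = 1"
    using E o(2,3) by (simp add: cr_edge_def tri bar jacobi_00)
  assume "E' \<noteq> E"
  show "\<exists>s. \<forall>t. cr_edge k E' K (linepath a b t) = s * poly (legendre_poly k) (2 * t - 1)"
  proof (cases "E' edge_of K")
    case True
    let ?p = "opposite_vertex K E'"
    have p: "verts K = insert ?p (verts E')" "?p \<notin> verts E'"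
      using opposite_vertex_eq[OF K True] verts_subset[of E'] by auto
    \<comment> \<open>Edges with the same opposite vertex would have the same endpoints and thus
      coincide.\<close>
    have "?p \<noteq> ?o"
    proof
      assume "?p = ?o"
      with p o ab have "verts E' = verts E" by (auto simp: insert_eq_iff)
      with edge_of_triangle(2)[OF K E] edge_of_triangle(2)[OF K True] \<open>E' \<noteq> E\<close> show False by metis
    qed
    with p(1) o(1) consider "?p = a" | "?p = b" by blast
    then show ?thesis
    proof cases
      case 1
      then have "cr_edge k E' K (linepath a b t) = 1 * poly (legendre_poly k) (2 * t - 1)" for t
        using True by (simp add: cr_edge_def tri bar jacobi_00)
      then show ?thesis by blast
    next
      case 2
      have "cr_edge k E' K (linepath a b t) = (- 1) * poly (legendre_poly k) (2 * t - 1)" for t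
        using True 2 \<open>a \<noteq> b\<close> \<open>odd k\<close> legendre_minus[of k "2 * t - 1"]
        by (simp add: cr_edge_def tri bar jacobi_00)
      then show ?thesis by blast
    qed
  next
    case False
    then show ?thesis by (intro exI[of _ 0]) (simp add: cr_edge_def)
  qed
qed

text \<open>The weight \<open>edge_weight\<close> pulled back to [-1,1].\<close>

definition edge_weight_poly :: "nat \<Rightarrow> nat \<Rightarrow> real poly" where
  "edge_weight_poly k \<nu> = smult (gam \<nu>) (jacobi11_poly \<nu> - smult (coef \<nu> k) (jacobi11_poly (k - 1)))"

text \<open>On the edge the hat function of \<open>A2 E\<close> is the path parameter
  \<open>t\<close>, and the edge length cancels.\<close>

lemma edge_functional_eq_poly_int:
  assumes T: "conforming_triangulation \<Omega> T" and K: "K \<in> T" and E: "E edge_of K"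
    and A: "verts E = {A1 E, A2 E}"
    and v: "\<And>t. t \<in> {0..1} \<Longrightarrow> v (linepath (A1 E) (A2 E) t) = poly p (2 * t - 1)"
  shows "edge_functional T A1 A2 k \<nu> E v = poly_int (edge_weight_poly k \<nu> * p)"
proof -
  have K2: "2 simplex K" using T K by (auto simp: conforming_triangulation_def)
  have ne: "A1 E \<noteq> A2 E" using edge_of_triangle(1)[OF K2 E] A by auto
  have "A1 E \<in> verts K" "A2 E \<in> verts K" using edge_of_triangle(3)[OF K2 E] A by auto
  with hat_linepath[OF T K] ne
  have "hat T (A2 E) (linepath (A1 E) (A2 E) t) = t" if "t \<in> {0..1}" for t
    using that by simp
  then have "integral {0..1} (\<lambda>t. edge_weight T A2 k \<nu> E (linepath (A1 E) (A2 E) t) * v (linepath (A1 E) (A2 E) t))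
      = integral {0..1} (\<lambda>t. poly (edge_weight_poly k \<nu> * p) (2 * t - 1))"
    using v by (intro integral_cong)
      (simp add: edge_weight_def edge_weight_poly_def jacobi_11[unfolded One_nat_def])
  then show ?thesis
    using ne integral_unit_interval_eq_poly_int[of "edge_weight_poly k \<nu> * p"]
    by (simp add: edge_functional_def segment_integral_def)
qed

text \<open>A different edge has an endpoint that is not an endpoint of \<open>E\<close>, and the
  hat function of that endpoint vanishes along \<open>E\<close>.\<close>

lemma edge_bubble_linepath:
  assumes T: "conforming_triangulation \<Omega> T" and K: "K \<in> T" and E: "E edge_of K" and E': "E' \<in> mesh_edges T"
    and A: "verts E = {A1 E, A2 E}" "verts E' = {A1 E', A2 E'}" and t: "t \<in> {0..1}"
  shows "edge_bubble T A1 A2 E' (linepath (A1 E) (A2 E) t) = (if E = E' then 1 - (2 * t - 1)\<^sup>2 else 0)"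
proof -
  have simplex: "\<And>K. K \<in> T \<Longrightarrow> 2 simplex K" using T by (auto simp: conforming_triangulation_def)
  have ne: "A1 E \<noteq> A2 E" using edge_of_triangle(1)[OF simplex[OF K] E] A by auto
  have "A1 E \<in> verts K" "A2 E \<in> verts K" using edge_of_triangle(3)[OF simplex[OF K] E] A by auto
  note hat = hat_linepath[OF T K this t]
  show ?thesis
  proof (cases "E = E'")
    case True
    with ne show ?thesis
      unfolding True[symmetric] by (simp add: edge_bubble_def hat power2_eq_square algebra_simps)
  next
    case False
    obtain K' where "K' \<in> T" "E' edge_of K'" using E' by (auto simp: mesh_edges_def)
    note E'K' = edge_of_triangle[OF simplex[OF this(1)] this(2)]
    have "verts E' \<noteq> verts E"
      using False edge_of_triangle(2)[OF simplex[OF K] E] E'K'(2) by metis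
    moreover have "A1 E' \<noteq> A2 E'" using E'K'(1) A(2) by auto
    ultimately have "A1 E' \<notin> {A1 E, A2 E} \<or> A2 E' \<notin> {A1 E, A2 E}"
      using A by auto
    with False show ?thesis by (auto simp: edge_bubble_def hat)
  qed
qed

section \<open>The three integrals against the edge weight\<close>

text \<open>The correction term of the weight has degree index \<open>k - 1\<close>, different from
  \<open>\<mu>\<close>, and drops out by orthogonality.\<close>

lemma poly_int_edge_weight_jacobi:
  assumes "\<nu> < k" "\<mu> < k - 1"
  shows "poly_int (edge_weight_poly k \<nu> * ([:1, 0, -1:] * jacobi11_poly \<mu>)) = (if \<nu> = \<mu> then 1 else 0)"
proof -
  have "edge_weight_poly k \<nu> * ([:1, 0, -1:] * jacobi11_poly \<mu>) =
      smult (gam \<nu>) ([:1, 0, -1:] * jacobi11_poly \<nu> * jacobi11_poly \<mu>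
        - smult (coef \<nu> k) ([:1, 0, -1:] * jacobi11_poly (k - 1) * jacobi11_poly \<mu>))"
    unfolding edge_weight_poly_def by (simp only: left_diff_distrib right_diff_distrib mult_smult_left mult_smult_right ac_simps)
  then have "poly_int (edge_weight_poly k \<nu> * ([:1, 0, -1:] * jacobi11_poly \<mu>)) =
      gam \<nu> * ((if \<nu> = \<mu> then 1 / gam \<nu> else 0) - coef \<nu> k * (if k - 1 = \<mu> then 1 / gam (k - 1) else 0))"
    by (simp only: poly_int_linear jacobi11_norm)
  with assms gam_pos[of \<nu>] show ?thesis by auto
qed

text \<open>\<open>coef\<close> is chosen for this: below \<open>k - 1\<close> it cancels the mean,
  and at \<open>k - 1\<close> it scales the mean to 1.\<close>

lemma poly_int_edge_weight:
  assumes "\<nu> < k" "odd k"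
  shows "poly_int (edge_weight_poly k \<nu>) = (if \<nu> = k - 1 then 1 else 0)"
proof -
  have k: "k \<ge> 1" using assms by simp
  \<comment> \<open>For odd \<open>k\<close> the parity factor equals 2.\<close>
  have last: "poly_int (jacobi11_poly (k - 1)) = 4 / (real k + 1)"
    using k \<open>odd k\<close> by (simp add: poly_int_jacobi11 of_nat_diff)
  show ?thesis
  proof (cases "\<nu> = k - 1")
    case True
    have "poly_int (edge_weight_poly k \<nu>) = gam (k - 1) * (1 - 1 / (2 * real k + 1)) * (4 / (real k + 1))"
      unfolding edge_weight_poly_def True poly_int_linear last coef_def by (simp add: algebra_simps)
    also have "\<dots> = 1"
      using k by (simp add: gam_def of_nat_diff divide_simps) (simp add: algebra_simps)
    finally show ?thesis using True by simp
  next
    case False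
    with assms have "\<nu> < k - 1" by simp
    with False show ?thesis
      by (simp add: edge_weight_poly_def poly_int_linear last[unfolded One_nat_def] poly_int_jacobi11[of \<nu>] coef_def)
         (simp add: field_simps)
  qed
qed

text \<open>The weight has degree at most \<open>k - 1\<close>, below that of the Legendre
  polynomial.\<close>

lemma poly_int_edge_weight_legendre:
  assumes "\<nu> < k"
  shows "poly_int (edge_weight_poly k \<nu> * legendre_poly k) = 0"
proof -
  have "degree (edge_weight_poly k \<nu>) \<le> k - 1"
    unfolding edge_weight_poly_def using assms
    by (intro order.trans[OF degree_smult_le] degree_diff_le) auto
  with assms show ?thesis
    using legendre_orthogonal[of "edge_weight_poly k \<nu>" k] by (simp add: mult.commute)
qed

text \<open>In each case the trace on \<open>E\<close> is written as a polynomial in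
  \<open>2 * t - 1\<close>. Since \<open>K\<close> is any triangle at \<open>E\<close>, traces from
  both sides are covered.\<close>

lemma edge_functional_edge_fun:
  assumes T: "conforming_triangulation \<Omega> T" and "odd k"
    and A: "\<And>E. E \<in> interior_edges \<Omega> T \<Longrightarrow> {A1 E, A2 E} = verts E"
    and "\<nu> < k" "\<mu> < k"
    and Ei: "E \<in> interior_edges \<Omega> T" "E' \<in> interior_edges \<Omega> T" and K: "K \<in> T" "E edge_of K"
  shows "edge_functional T A1 A2 k \<nu> E (edge_fun T A1 A2 k \<mu> E' K) =
    (if \<nu> = \<mu> then 1 else 0) * (if E = E' then 1 else 0)"
proof -
  have K2: "2 simplex K" using T K by (auto simp: conforming_triangulation_def)
  have vE: "verts E = {A1 E, A2 E}" and vE': "verts E' = {A1 E', A2 E'}" using A Ei by auto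
  have E': "E' \<in> mesh_edges T" using Ei by (simp add: interior_edges_def)
  note functional = edge_functional_eq_poly_int[where ?A1.0 = A1 and ?A2.0 = A2 and E = E, OF T K vE]
  show ?thesis
  proof (cases "\<mu> < k - 1")
    case True
    have "edge_fun T A1 A2 k \<mu> E' K (linepath (A1 E) (A2 E) t) =
        poly (if E = E' then [:1, 0, -1:] * jacobi11_poly \<mu> else 0) (2 * t - 1)" if t: "t \<in> {0..1}" for t
    proof (cases "E = E'")
      case False
      with True show ?thesis by (simp add: edge_fun_def edge_bubble_linepath[OF T K E' vE vE' t])
    next
      case eq: True
      have bubble: "edge_bubble T A1 A2 E (linepath (A1 E) (A2 E) t) = 1 - (2 * t - 1)\<^sup>2"
        using edge_bubble_linepath[OF T K E' vE vE' t] by (simp add: eq)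
      have "A1 E \<noteq> A2 E" "A1 E \<in> verts K" "A2 E \<in> verts K"
        using edge_of_triangle(1,3)[OF K2 K(2)] vE by auto
      with hat_linepath[OF T K(1) _ _ t] have "hat T (A2 E) (linepath (A1 E) (A2 E) t) = t" by simp
      with True show ?thesis
        unfolding edge_fun_def eq[symmetric]
        by (simp add: bubble
            jacobi_11[unfolded One_nat_def] power2_eq_square algebra_simps)
    qed
    from functional[where v = "edge_fun T A1 A2 k \<mu> E' K", OF this] poly_int_edge_weight_jacobi[OF \<open>\<nu> < k\<close> True]
    show ?thesis by simp
  next
    case False
    with \<open>\<mu> < k\<close> have \<mu>: "\<mu> = k - 1" by simp
    show ?thesis
    proof (cases "E = E'")
      case True
      have "edge_fun T A1 A2 k \<mu> E' K (linepath (A1 E) (A2 E) t) = poly 1 (2 * t - 1)" for t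
        using cr_edge_linepath(1)[OF K2 K(2) vE \<open>odd k\<close>] True by (simp add: edge_fun_def \<mu>)
      from functional[where v = "edge_fun T A1 A2 k \<mu> E' K", OF this] poly_int_edge_weight[OF \<open>\<nu> < k\<close> \<open>odd k\<close>]
      show ?thesis using True \<mu> by simp
    next
      case False
      then obtain s where "\<And>t. cr_edge k E' K (linepath (A1 E) (A2 E) t) = s * poly (legendre_poly k) (2 * t - 1)"
        using cr_edge_linepath(2)[OF K2 K(2) vE \<open>odd k\<close>, of E'] by auto
      then have "edge_fun T A1 A2 k \<mu> E' K (linepath (A1 E) (A2 E) t) = poly (smult s (legendre_poly k)) (2 * t - 1)" for t
        by (simp add: edge_fun_def \<mu>)
      from functional[where v = "edge_fun T A1 A2 k \<mu> E' K", OF this] poly_int_edge_weight_legendre[OF \<open>\<nu> < k\<close>]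
      show ?thesis using False by (simp add: poly_int_linear)
    qed
  qed
qed

theorem lemma29:
  fixes \<Omega> :: "(real ^ 2) set" and T :: "(real ^ 2) set set" and k :: nat
    and A1 A2 :: "(real ^ 2) set \<Rightarrow> real ^ 2"
  assumes "polygonal_lipschitz_domain \<Omega>"
    and "conforming_triangulation \<Omega> T"
    and "1 \<le> k" and "odd k"
    and "\<And>E. E \<in> interior_edges \<Omega> T \<Longrightarrow> {A1 E, A2 E} = verts E"
  shows "\<forall>\<nu>\<in>{0..k - 1}. \<forall>\<mu>\<in>{0..k - 1}.
           \<forall>E\<in>interior_edges \<Omega> T. \<forall>E'\<in>interior_edges \<Omega> T.
             (\<forall>K\<in>T. E edge_of K \<longrightarrow>
                edge_functional T A1 A2 k \<nu> E (edge_fun T A1 A2 k \<mu> E' K)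
                  = (if \<nu> = \<mu> then 1 else 0) * (if E = E' then 1 else 0)) \<and>
             (\<forall>u\<in>S_bubble \<Omega> T k. edge_functional T A1 A2 k \<nu> E u = 0)"
proof (intro ballI conjI impI)
  fix \<nu> \<mu> E E' K
  assume "\<nu> \<in> {0..k - 1}" "\<mu> \<in> {0..k - 1}" "E \<in> interior_edges \<Omega> T" "E' \<in> interior_edges \<Omega> T"
    "K \<in> T" "E edge_of K"
  with assms show "edge_functional T A1 A2 k \<nu> E (edge_fun T A1 A2 k \<mu> E' K)
      = (if \<nu> = \<mu> then 1 else 0) * (if E = E' then 1 else 0)"
    by (intro edge_functional_edge_fun) auto
next
  fix \<nu> E u
  assume "E \<in> interior_edges \<Omega> T" and u: "u \<in> S_bubble \<Omega> T k"
  then obtain K where K: "K \<in> T" "E edge_of K" and E: "E \<in> mesh_edges T"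
    and vE: "verts E = {A1 E, A2 E}"
    using assms(5)[of E] by (auto simp: interior_edges_def mesh_edges_def)
  \<comment> \<open>This places the integration path inside \<open>E\<close>, where \<open>u\<close>
    vanishes, so its trace is the zero polynomial.\<close>
  have "E = closed_segment (A1 E) (A2 E)"
    using edge_of_triangle(2)[OF _ K(2)] assms(2) K(1) vE
    by (metis conforming_triangulation_def segment_convex_hull)
  then have "u (linepath (A1 E) (A2 E) t) = poly 0 (2 * t - 1)" if "t \<in> {0..1}" for t
    using u E linepath_in_path[OF that, of "A1 E" "A2 E"] by (simp add: S_bubble_def)
  from edge_functional_eq_poly_int[where v = u and E = E and ?A1.0 = A1 and ?A2.0 = A2, OF assms(2) K vE this]
  show "edge_functional T A1 A2 k \<nu> E u = 0" by simp
qed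

end
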